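(* Let $\eta,\eta'\in\Omega^*$. Then $\nu_{\eta'}\ll\nu_{\eta}$ if and only if $\eta'\in o_-(\eta)$.
   Context: $\mathbb{N}=\{1,2,3,\dots\}$, $\beta\mathbb{N}$ is its Stone–Čech compactification and $\mathbb{N}^*=\beta\mathbb{N}\setminus\mathbb{N}$, whose points are the free ultrafilters on $\mathbb{N}$. Let $\tau:\beta\mathbb{N}\to\beta\mathbb{N}$ be the continuous extension of $n\mapsto n+1$; its restriction to $\mathbb{N}^*$ is a homeomorphism of $\mathbb{N}^*$ onto itself. $\Omega^*$ is the quotient space of $\mathbb{N}^*\times[0,1]$ obtained by identifying $(\omega,1)$ with $(\tau\omega,0)$ for all $\omega\in\mathbb{N}^*$. For $s\in\mathbb{R}$, the homeomorphism $\phi^s:\Omega^*\to\Omega^*$ is $\phi^s(\omega,t)=(\tau^{[t+s]}\omega,\ t+s-[t+s])$, where $[x]$ is the largest integer not exceeding $x$. Put $o_-(\eta)=\{\phi^{-s}(\eta): s\ge 0\}$. For $\eta=(\omega,t)\in\Omega^*$, with $\theta=2^t$, $\nu_\eta$ is the finitely additive probability measure on $\mathcal{P}(\mathbb{N})$ given by $\nu_\eta(A)=\omega\text{-}\lim_n \frac{|A\cap\{1,\dots,[\theta\cdot 2^n]\}|}{\theta\cdot 2^n}$, the limit being taken along the ultrafilter $\omega$. For finitely additive probability measures $\mu,\nu$ on $\mathcal{P}(\mathbb{N})$, $\nu\ll\mu$ means that for every $\varepsilon>0$ there is $\delta>0$ such that for all $A\in\mathcal{P}(\mathbb{N})$, $\mu(A)<\delta$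 implies $\nu(A)<\varepsilon$. *)

theory Defs
  imports "HOL-Analysis.Analysis"
begin

section \<open>The Stone-Cech compactification of the positive integers\<close>

text \<open>
  The positive integers are the subset \<open>{1..}\<close> of type \<^typ>\<open>nat\<close>. Points of the compactification
  are the ultrafilters on that set, represented as filters on \<^typ>\<open>nat\<close> that contain \<open>{1..}\<close>.
\<close>

definition is_ultrafilter :: "'a filter \<Rightarrow> bool" where
  "is_ultrafilter F \<longleftrightarrow> F \<noteq> bot \<and> (\<forall>P. eventually P F \<or> eventually (\<lambda>x. \<not> P x) F)"

lemma is_ultrafilter_principal: "is_ultrafilter (principal {x})"
  by (auto simp: is_ultrafilter_def eventually_principal principal_eq_bot_iff)

typedef betaN = "{F :: nat filter. is_ultrafilter F \<and> F \<le> principal {1..}}"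
  morphisms ufilter BetaN
  by (rule exI[of _ "principal {1}"]) (simp add: is_ultrafilter_principal)

setup_lifting type_definition_betaN

lemma ufilter_not: "eventually (\<lambda>n. \<not> P n) (ufilter p) \<longleftrightarrow> \<not> eventually P (ufilter p)"
proof -
  have u: "is_ultrafilter (ufilter p)" using ufilter[of p] by simp
  have "\<not> (eventually P (ufilter p) \<and> eventually (\<lambda>n. \<not> P n) (ufilter p))"
  proof
    assume "eventually P (ufilter p) \<and> eventually (\<lambda>n. \<not> P n) (ufilter p)"
    then have "eventually (\<lambda>n. False) (ufilter p)"
      by (auto elim: eventually_elim2)
    with u show False by (simp add: is_ultrafilter_def eventually_False)
  qed
  with u show ?thesis unfolding is_ultrafilter_def by blast
qed

lemma ufilter_nontriv [simp]: "ufilter p \<noteq> bot"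
  using ufilter[of p] by (simp add: is_ultrafilter_def)

lemma ufilter_happens: "eventually P (ufilter p) \<Longrightarrow> \<exists>n. P n"
  by (rule eventually_happens'[OF ufilter_nontriv])

lemma ufilter_pos: "eventually (\<lambda>n. n \<ge> 1) (ufilter p)"
  using ufilter[of p] by (auto simp: le_principal)

definition betaN_point :: "nat \<Rightarrow> betaN" where
  "betaN_point n = BetaN (principal {n})"

lemma ufilter_betaN_point: "n \<ge> 1 \<Longrightarrow> ufilter (betaN_point n) = principal {n}"
  unfolding betaN_point_def by (rule BetaN_inverse) (simp add: is_ultrafilter_principal)

text \<open>The Stone topology: a basis is given by the sets of all ultrafilters containing a given set.\<close>

definition stone_set :: "nat set \<Rightarrow> betaN set" where
  "stone_set A = {p. eventually (\<lambda>n. n \<in> A) (ufilter p)}"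

lemma stone_set_Int: "stone_set (A \<inter> B) = stone_set A \<inter> stone_set B"
  by (auto simp: stone_set_def eventually_conj_iff)

lemma stone_set_Compl: "stone_set (- A) = - stone_set A"
  by (auto simp: stone_set_def ufilter_not)

instantiation betaN :: t2_space
begin

definition open_betaN :: "betaN set \<Rightarrow> bool" where
  "open_betaN U \<longleftrightarrow> (\<forall>p\<in>U. \<exists>A. p \<in> stone_set A \<and> stone_set A \<subseteq> U)"

instance
proof
  show "open (UNIV :: betaN set)"
    unfolding open_betaN_def by (auto simp: stone_set_def intro: exI[of _ UNIV])
next
  fix S T :: "betaN set"
  assume S: "open S" and T: "open T"
  show "open (S \<inter> T)"
    unfolding open_betaN_def
  proof
    fix p assume "p \<in> S \<inter> T"
    then obtain A B where "p \<in> stone_set A" "stone_set A \<subseteq> S" "p \<in> stone_set B" "stone_set B \<subseteq> T"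
      using S T unfolding open_betaN_def by blast
    then show "\<exists>C. p \<in> stone_set C \<and> stone_set C \<subseteq> S \<inter> T"
      by (intro exI[of _ "A \<inter> B"]) (auto simp: stone_set_Int)
  qed
next
  fix K :: "betaN set set"
  assume "\<forall>S\<in>K. open S"
  then show "open (\<Union>K)"
    unfolding open_betaN_def by (meson Union_iff Union_upper order_trans)
next
  fix p q :: betaN
  assume "p \<noteq> q"
  then have "ufilter p \<noteq> ufilter q" by (simp add: ufilter_inject)
  then obtain P where "eventually P (ufilter p) \<noteq> eventually P (ufilter q)"
    by (auto simp: filter_eq_iff)
  then obtain Q where Q: "eventually Q (ufilter p)" "\<not> eventually Q (ufilter q)"
    using ufilter_not[of P] by blast
  have o: "open (stone_set A)" for A by (auto simp: open_betaN_def)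
  have "p \<in> stone_set {n. Q n}" "q \<in> stone_set (- {n. Q n})"
    using Q by (auto simp: stone_set_def ufilter_not)
  moreover have "stone_set {n. Q n} \<inter> stone_set (- {n. Q n}) = {}"
    by (simp add: stone_set_Compl)
  ultimately show "\<exists>U V. open U \<and> open V \<and> p \<in> U \<and> q \<in> V \<and> U \<inter> V = {}"
    using o by blast
qed

end

lemma open_stone_set: "open (stone_set A)"
  by (auto simp: open_betaN_def)

lemma betaN_point_dense: "closure (betaN_point ` {1..}) = UNIV"
proof -
  have "\<exists>n\<ge>1. betaN_point n \<in> U" if U: "open U" "p \<in> U" for U p
  proof -
    obtain A where A: "p \<in> stone_set A" "stone_set A \<subseteq> U"
      using U unfolding open_betaN_def by blast
    have "eventually (\<lambda>n. n \<in> A \<and> n \<ge> 1) (ufilter p)"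
      using A(1) ufilter_pos[of p] by (simp add: stone_set_def eventually_conj_iff)
    then obtain n where n: "n \<in> A" "n \<ge> 1"
      by (auto dest: ufilter_happens)
    then have "betaN_point n \<in> stone_set A"
      by (simp add: stone_set_def ufilter_betaN_point eventually_principal)
    with A n show ?thesis by blast
  qed
  then show ?thesis
    unfolding set_eq_iff closure_iff_nhds_not_empty
    by (metis IntI UNIV_I atLeast_iff empty_iff imageI subset_eq)
qed


section \<open>The shift\<close>

definition tau :: "betaN \<Rightarrow> betaN" where
  "tau = (THE f. continuous_on UNIV f \<and> (\<forall>n\<ge>1. f (betaN_point n) = betaN_point (n + 1)))"

lemma is_ultrafilter_filtermap: "is_ultrafilter F \<Longrightarrow> is_ultrafilter (filtermap f F)"
  by (auto simp: is_ultrafilter_def filtermap_bot_iff eventually_filtermap)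

lemma BetaN_filtermap_Suc: "ufilter (BetaN (filtermap Suc (ufilter p))) = filtermap Suc (ufilter p)"
  by (rule BetaN_inverse)
     (use ufilter[of p] in \<open>auto simp: le_principal eventually_filtermap is_ultrafilter_filtermap\<close>)

lemma tau_unique:
  "\<exists>!f. continuous_on UNIV f \<and> (\<forall>n\<ge>1. f (betaN_point n) = betaN_point (n + 1))"
  and tau_eq: "tau p = BetaN (filtermap Suc (ufilter p))"
proof -
  define g where "g p = BetaN (filtermap Suc (ufilter p))" for p
  have g_ufilter: "ufilter (g p) = filtermap Suc (ufilter p)" for p
    unfolding g_def by (rule BetaN_filtermap_Suc)
  have vimage: "g -` stone_set A = stone_set (Suc -` A)" for A
    by (auto simp: stone_set_def g_ufilter eventually_filtermap)
  have "open (g -` U)" if "open U" for U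
    unfolding open_betaN_def
  proof
    fix p assume "p \<in> g -` U"
    then obtain A where "g p \<in> stone_set A" "stone_set A \<subseteq> U"
      using \<open>open U\<close> unfolding open_betaN_def by blast
    then show "\<exists>B. p \<in> stone_set B \<and> stone_set B \<subseteq> g -` U"
      by (intro exI[of _ "Suc -` A"]) (simp add: vimage[symmetric] vimage_mono)
  qed
  then have g_cont: "continuous_on UNIV g"
    by (simp add: continuous_on_open_vimage)
  have g_point: "\<forall>n\<ge>1. g (betaN_point n) = betaN_point (n + 1)"
    unfolding ufilter_inject[symmetric] by (simp add: g_ufilter ufilter_betaN_point)
  have uniq: "f = g" if f: "continuous_on UNIV f" "\<forall>n\<ge>1. f (betaN_point n) = betaN_point (n + 1)" for f
  proof -
    have "closed {p. f p = g p}"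
      using f(1) g_cont by (rule closed_Collect_eq)
    moreover have "betaN_point ` {1..} \<subseteq> {p. f p = g p}"
      using f(2) g_point by auto
    ultimately have "closure (betaN_point ` {1..}) \<subseteq> {p. f p = g p}"
      by (simp add: closure_minimal)
    then show ?thesis unfolding betaN_point_dense by auto
  qed
  show "\<exists>!f. continuous_on UNIV f \<and> (\<forall>n\<ge>1. f (betaN_point n) = betaN_point (n + 1))"
  proof (rule ex1I)
    show "continuous_on UNIV g \<and> (\<forall>n\<ge>1. g (betaN_point n) = betaN_point (n + 1))"
      using g_cont g_point by (rule conjI)
  qed (elim conjE, rule uniq)
  have "tau = g"
    unfolding tau_def
  proof (rule the_equality)
    show "continuous_on UNIV g \<and> (\<forall>n\<ge>1. g (betaN_point n) = betaN_point (n + 1))"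
      using g_cont g_point by (rule conjI)
  qed (elim conjE, rule uniq)
  show "tau p = BetaN (filtermap Suc (ufilter p))" unfolding \<open>tau = g\<close> by (rule g_def)
qed

lemma ufilter_tau: "ufilter (tau p) = filtermap Suc (ufilter p)"
  by (simp add: tau_eq BetaN_filtermap_Suc)

definition Nstar :: "betaN set" where
  "Nstar = UNIV - betaN_point ` {1..}"

lemma ufilter_fixed: 
  assumes "eventually (\<lambda>n. n = k) (ufilter p)"
  shows "p \<in> betaN_point ` {1..}"
proof -
  have "eventually (\<lambda>n. n = k \<and> n \<ge> 1) (ufilter p)"
    using assms ufilter_pos by (rule eventually_conj)
  then have k: "k \<ge> 1"
    by (auto dest: ufilter_happens)
  have "eventually P (ufilter p) \<longleftrightarrow> P k" for P
  proof
    assume "eventually P (ufilter p)"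
    with assms have "eventually (\<lambda>n. n = k \<and> P n) (ufilter p)" by (rule eventually_conj)
    then show "P k" by (auto dest: ufilter_happens)
  next
    assume "P k"
    with assms show "eventually P (ufilter p)" by (auto elim: eventually_mono)
  qed
  then have "ufilter p = ufilter (betaN_point k)"
    using k by (simp add: filter_eq_iff ufilter_betaN_point eventually_principal)
  with k show ?thesis by (simp add: ufilter_inject)
qed

lemma Nstar_iff_free: "p \<in> Nstar \<longleftrightarrow> ufilter p \<le> sequentially"
proof
  assume p: "p \<in> Nstar"
  have "eventually (\<lambda>n. n \<ge> N) (ufilter p)" for N
  proof (induction N)
    case (Suc N)
    have "\<not> eventually (\<lambda>n. n = N) (ufilter p)"
      using p ufilter_fixed unfolding Nstar_def by blast
    then have "eventually (\<lambda>n. n \<noteq> N) (ufilter p)" by (simp add: ufilter_not)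
    with Suc show ?case by eventually_elim simp
  qed simp
  then show "ufilter p \<le> sequentially"
    unfolding le_sequentially by blast
next
  assume le: "ufilter p \<le> sequentially"
  show "p \<in> Nstar"
  proof (rule ccontr)
    assume "p \<notin> Nstar"
    then obtain k where "k \<ge> 1" "p = betaN_point k" by (auto simp: Nstar_def)
    then have "principal {k} \<le> sequentially" using le by (simp add: ufilter_betaN_point)
    moreover have "eventually (\<lambda>n. n > k) sequentially" by (rule eventually_gt_at_top)
    ultimately have "eventually (\<lambda>n. n > k) (principal {k})" by (rule filter_leD)
    then show False by (simp add: eventually_principal)
  qed
qed

lemma tau_Nstar: "tau p \<in> Nstar \<longleftrightarrow> p \<in> Nstar"
proof -
  have "filtermap Suc (ufilter p) \<le> sequentially \<longleftrightarrow> ufilter p \<le> sequentially"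
  proof -
    have "filtermap Suc F \<le> sequentially \<longleftrightarrow> F \<le> sequentially" for F :: "nat filter"
    proof
      assume "filtermap Suc F \<le> sequentially"
      then have "filterlim Suc sequentially F" by (simp add: filterlim_def)
      then show "F \<le> sequentially"
        unfolding filterlim_at_top le_sequentially
        by (metis (mono_tags, lifting) Suc_le_mono eventually_mono)
    next
      assume "F \<le> sequentially"
      then show "filtermap Suc F \<le> sequentially"
        using filtermap_mono[of F sequentially Suc] filterlim_Suc
        by (auto simp: filterlim_def intro: order_trans)
    qed
    then show ?thesis .
  qed
  then show ?thesis by (simp add: Nstar_iff_free ufilter_tau)
qed

lemma bij_betw_tau_Nstar: "bij_betw tau Nstar Nstar"
  unfolding bij_betw_def
proof
  have "inj tau"
  proof (rule injI)
    fix p q assume "tau p = tau q"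
    then have "filtermap Suc (ufilter p) = filtermap Suc (ufilter q)" by (metis ufilter_tau)
    then show "p = q"
      by (simp add: filtermap_eq_strong ufilter_inject)
  qed
  then show "inj_on tau Nstar" by (rule inj_on_subset) simp
  show "tau ` Nstar = Nstar"
  proof
    show "tau ` Nstar \<subseteq> Nstar" by (auto simp: tau_Nstar)
    show "Nstar \<subseteq> tau ` Nstar"
    proof
      fix q assume q: "q \<in> Nstar"
      define F where "F = filtermap (\<lambda>n. n - 1) (ufilter q)"
      have ev: "eventually (\<lambda>n. n \<ge> 2) (ufilter q)"
        using q unfolding Nstar_iff_free by (rule filter_leD) (rule eventually_ge_at_top)
      then have "eventually (\<lambda>n. n \<ge> 1) F"
        unfolding F_def eventually_filtermap by eventually_elim simp
      then have "F \<in> {F. is_ultrafilter F \<and> F \<le> principal {1..}}"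
        using ufilter[of q] by (auto simp: F_def is_ultrafilter_filtermap le_principal)
      then have F: "ufilter (BetaN F) = F" by (rule BetaN_inverse)
      have "filtermap Suc F = filtermap (\<lambda>n. n) (ufilter q)"
        unfolding filter_eq_iff F_def eventually_filtermap
        using ev by (auto intro!: eventually_cong elim: eventually_mono)
      then have "ufilter (tau (BetaN F)) = ufilter q" by (simp add: ufilter_tau F filtermap_ident)
      then have "tau (BetaN F) = q" by (simp add: ufilter_inject)
      then show "q \<in> tau ` Nstar" using q tau_Nstar by blast
    qed
  qed
qed

text \<open>Integer iterates of the bijection \<open>tau\<close> of \<open>Nstar\<close>.\<close>

definition tau_pow :: "int \<Rightarrow> betaN \<Rightarrow> betaN" where
  "tau_pow k = (if k \<ge> 0 then tau ^^ nat k else inv_into Nstar tau ^^ nat (- k))"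

lemma inv_tau_Nstar:
  assumes "p \<in> Nstar"
  shows "inv_into Nstar tau p \<in> Nstar" "tau (inv_into Nstar tau p) = p" "inv_into Nstar tau (tau p) = p"
  using bij_betw_tau_Nstar assms
  by (auto simp: bij_betw_def inv_into_into f_inv_into_f)

lemma tau_pow_Nstar: "p \<in> Nstar \<Longrightarrow> tau_pow k p \<in> Nstar"
proof -
  assume p: "p \<in> Nstar"
  have "(tau ^^ n) p \<in> Nstar" for n by (induction n) (auto simp: p tau_Nstar)
  moreover have "(inv_into Nstar tau ^^ n) p \<in> Nstar" for n
    by (induction n) (auto simp: p inv_tau_Nstar)
  ultimately show ?thesis by (simp add: tau_pow_def)
qed

lemma tau_pow_tau: "p \<in> Nstar \<Longrightarrow> tau_pow k (tau p) = tau_pow (k + 1) p"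
proof -
  assume p: "p \<in> Nstar"
  show ?thesis
  proof (cases "k \<ge> 0")
    case True
    then have "nat (k + 1) = Suc (nat k)" by simp
    with True show ?thesis by (simp add: tau_pow_def funpow_swap1)
  next
    case False
    then obtain m where m: "nat (- k) = Suc m" by (metis gr0_implies_Suc neg_0_less_iff_less not_le zero_less_nat_eq)
    then have k: "k = - int (Suc m)" using False by linarith
    have "tau_pow k (tau p) = (inv_into Nstar tau ^^ m) p"
      using False m p by (simp add: tau_pow_def funpow_swap1 inv_tau_Nstar)
    also have "\<dots> = tau_pow (k + 1) p"
    proof (cases m)
      case 0
      then show ?thesis by (simp add: tau_pow_def k)
    next
      case (Suc j)
      then have "nat (- (k + 1)) = m" "\<not> k + 1 \<ge> 0" using k by auto
      then show ?thesis by (simp add: tau_pow_def)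
    qed
    finally show ?thesis .
  qed
qed


section \<open>The quotient space and the flow\<close>

lemma Nstar_nonempty: "Nstar \<noteq> {}"
proof -
  define A where "A = {F :: nat filter. F \<noteq> bot \<and> F \<le> sequentially}"
  let ?R = "relation_of (\<lambda>F G. G \<le> F) A"
  have "\<exists>M\<in>A. \<forall>F\<in>A. F \<le> M \<longrightarrow> F = M"
  proof (rule predicate_Zorn)
    show "partial_order_on A ?R"
      by (rule partial_order_on_relation_ofI) auto
    fix C assume C: "C \<in> Chains ?R"
    then have CA: "C \<subseteq> A" and lin: "\<And>F G. F \<in> C \<Longrightarrow> G \<in> C \<Longrightarrow> F \<le> G \<or> G \<le> F"
      by (auto simp: Chains_def relation_of_def)
    show "\<exists>U\<in>A. \<forall>F\<in>C. U \<le> F"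
    proof (cases "C = {}")
      case True
      then show ?thesis by (auto simp: A_def intro: exI[of _ sequentially])
    next
      case False
      have "eventually P (Inf C) \<longleftrightarrow> (\<exists>F\<in>C. eventually P F)" for P
      proof (rule eventually_Inf_base)
        show "C \<noteq> {}" by fact
        show "\<exists>H\<in>C. H \<le> inf F G" if "F \<in> C" "G \<in> C" for F G
          using lin[OF that] that by (metis inf_absorb1 inf_absorb2 order_refl)
      qed
      from this[of "\<lambda>n. False"] have "Inf C \<noteq> bot"
        using CA by (auto simp: A_def eventually_False)
      moreover have "Inf C \<le> sequentially"
        using False CA unfolding A_def by (blast intro: Inf_lower2)
      ultimately show ?thesis by (intro bexI[of _ "Inf C"]) (auto simp: A_def Inf_lower)
    qed
  qed
  then obtain M where M: "M \<noteq> bot" "M \<le> sequentially"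
    and min: "\<And>F. F \<noteq> bot \<Longrightarrow> F \<le> M \<Longrightarrow> F = M"
    unfolding A_def by (auto intro: order_trans)
  have "eventually P M \<or> eventually (\<lambda>n. \<not> P n) M" for P
  proof (rule disjCI)
    assume "\<not> eventually (\<lambda>n. \<not> P n) M"
    then have "inf M (principal {n. P n}) \<noteq> bot"
      by (simp add: trivial_limit_def eventually_inf_principal)
    then have "inf M (principal {n. P n}) = M" by (intro min) auto
    then have "M \<le> principal {n. P n}" by (metis inf.cobounded2)
    then show "eventually P M" by (simp add: le_principal)
  qed
  moreover have "eventually (\<lambda>n. n \<ge> 1) M"
    using M(2) by (rule filter_leD) (rule eventually_ge_at_top)
  ultimately have "ufilter (BetaN M) = M"
    using M by (intro BetaN_inverse) (auto simp: is_ultrafilter_def le_principal)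
  then have "BetaN M \<in> Nstar" by (simp add: Nstar_iff_free M)
  then show ?thesis by blast
qed

text \<open>Points of \<open>Nstar \<times> {0..1}\<close>, with \<open>(\<omega>, 1)\<close> and \<open>(tau \<omega>, 0)\<close> identified.\<close>

definition omega_rel :: "betaN \<times> real \<Rightarrow> betaN \<times> real \<Rightarrow> bool" where
  "omega_rel x y \<longleftrightarrow> x \<in> Nstar \<times> {0..1} \<and> y \<in> Nstar \<times> {0..1} \<and>
     (x = y
      \<or> (\<exists>\<omega>. x = (\<omega>, 1) \<and> y = (tau \<omega>, 0))
      \<or> (\<exists>\<omega>. y = (\<omega>, 1) \<and> x = (tau \<omega>, 0)))"

quotient_type Omega_star = "betaN \<times> real" / partial: omega_rel
proof (rule part_equivpI)
  obtain \<omega> where "\<omega> \<in> Nstar" using Nstar_nonempty by blast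
  then have "omega_rel (\<omega>, 0) (\<omega>, 0)" by (simp add: omega_rel_def)
  then show "\<exists>x. omega_rel x x" ..
  show "symp omega_rel" by (rule sympI) (auto simp: omega_rel_def)
  have inj: "\<omega> = \<omega>'" if "\<omega> \<in> Nstar" "\<omega>' \<in> Nstar" "tau \<omega> = tau \<omega>'" for \<omega> \<omega>'
    using bij_betw_tau_Nstar that by (auto simp: bij_betw_def dest: inj_onD)
  show "transp omega_rel"
    by (rule transpI) (auto simp: omega_rel_def intro: inj)
qed

lemma omega_rel_cases:
  assumes "omega_rel x y"
  obtains "x = y" "x \<in> Nstar \<times> {0..1}"
  | \<omega> where "\<omega> \<in> Nstar" "x = (\<omega>, 1)" "y = (tau \<omega>, 0)"
  | \<omega> where "\<omega> \<in> Nstar" "y = (\<omega>, 1)" "x = (tau \<omega>, 0)"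
  using assms by (auto simp: omega_rel_def)

lift_definition phi :: "real \<Rightarrow> Omega_star \<Rightarrow> Omega_star" is
  "\<lambda>s (\<omega>, t). (tau_pow \<lfloor>t + s\<rfloor> \<omega>, t + s - of_int \<lfloor>t + s\<rfloor>)"
proof -
  fix s :: real and x y
  let ?f = "\<lambda>(\<omega>, t). (tau_pow \<lfloor>t + s\<rfloor> \<omega>, t + s - of_int \<lfloor>t + s\<rfloor>)"
  assume xy: "omega_rel x y"
  have mem: "?f z \<in> Nstar \<times> {0..1}" if "z \<in> Nstar \<times> {0..1}" for z
    using that by (auto simp: tau_pow_Nstar algebra_simps) linarith
  have eq: "?f (\<omega>, 1) = ?f (tau \<omega>, 0)" if "\<omega> \<in> Nstar" for \<omega>
    using that by (simp add: tau_pow_tau add.commute[of 1 s])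
  have "?f x = ?f y"
    using xy by (rule omega_rel_cases) (use eq in \<open>simp_all only:\<close>)
  moreover have "x \<in> Nstar \<times> {0..1}" using xy by (simp add: omega_rel_def)
  ultimately show "omega_rel (?f x) (?f y)"
    using mem[of x] unfolding omega_rel_def by metis
qed

definition o_minus :: "Omega_star \<Rightarrow> Omega_star set" where
  "o_minus \<eta> = {phi (- s) \<eta> | s. s \<ge> 0}"


section \<open>The densities and absolute continuity\<close>

text \<open>The limit along an ultrafilter is \<^const>\<open>Lim\<close> along the corresponding filter.\<close>

definition nu_rep :: "betaN \<times> real \<Rightarrow> nat set \<Rightarrow> real" where
  "nu_rep x A = (let (\<omega>, t) = x; \<theta> = 2 powr t in
     Lim (ufilter \<omega>) (\<lambda>n. real (card (A \<inter> {1..nat \<lfloor>\<theta> * 2 ^ n\<rfloor>})) / (\<theta> * 2 ^ n)))"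

lemma Lim_filtermap: "Lim (filtermap g F) f = Lim F (\<lambda>x. f (g x))"
  by (simp add: Topological_Spaces.Lim_def filterlim_filtermap)

lift_definition nu :: "Omega_star \<Rightarrow> nat set \<Rightarrow> real" is nu_rep
proof -
  fix x y
  assume "omega_rel x y"
  moreover have "nu_rep (\<omega>, 1) = nu_rep (tau \<omega>, 0)" for \<omega>
    unfolding nu_rep_def by (rule ext) (simp add: ufilter_tau Lim_filtermap)
  ultimately show "nu_rep x = nu_rep y"
    by (auto elim: omega_rel_cases)
qed

definition fin_add_prob :: "(nat set \<Rightarrow> real) \<Rightarrow> bool" where
  "fin_add_prob \<mu> \<longleftrightarrow> \<mu> {1..} = 1 \<and> (\<forall>A\<subseteq>{1..}. 0 \<le> \<mu> A) \<and>
     (\<forall>A\<subseteq>{1..}. \<forall>B\<subseteq>{1..}. A \<inter> B = {} \<longrightarrow> \<mu> (A \<union> B) = \<mu> A + \<mu> B)"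

lemma ultrafilter_bounded_tendsto:
  fixes f :: "nat \<Rightarrow> real"
  assumes "\<And>n. 0 \<le> f n" "\<And>n. f n \<le> 1"
  shows "(f \<longlongrightarrow> Lim (ufilter p) f) (ufilter p)"
proof -
  have "eventually (\<lambda>x. x \<in> {0..1}) (filtermap f (ufilter p))"
    using assms by (simp add: eventually_filtermap)
  moreover have "filtermap f (ufilter p) \<noteq> bot" by (simp add: filtermap_bot_iff)
  ultimately obtain l where l: "inf (nhds l) (filtermap f (ufilter p)) \<noteq> bot"
    using compact_Icc[of "0::real" 1] unfolding compact_filter by metis
  have "(f \<longlongrightarrow> l) (ufilter p)"
  proof (rule topological_tendstoI)
    fix S assume S: "open S" "l \<in> S"
    show "eventually (\<lambda>n. f n \<in> S) (ufilter p)"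
    proof (rule ccontr)
      assume "\<not> ?thesis"
      then have "eventually (\<lambda>x. x \<notin> S) (filtermap f (ufilter p))"
        by (simp add: eventually_filtermap ufilter_not)
      moreover have "eventually (\<lambda>x. x \<in> S) (nhds l)" using S by (rule eventually_nhds_in_open)
      ultimately have "eventually (\<lambda>x. False) (inf (nhds l) (filtermap f (ufilter p)))"
        unfolding eventually_inf by fastforce
      with l show False by (simp add: eventually_False)
    qed
  qed
  then show ?thesis using tendsto_Lim[OF ufilter_nontriv] by metis
qed

lemma nu_rep_tendsto:
  "((\<lambda>n. real (card (A \<inter> {1..nat \<lfloor>2 powr t * 2 ^ n\<rfloor>})) / (2 powr t * 2 ^ n)) \<longlongrightarrow> nu_rep (\<omega>, t) A)
     (ufilter \<omega>)"
proof -
  have "real (card (A \<inter> {1..nat \<lfloor>2 powr t * 2 ^ n\<rfloor>})) \<le> 2 powr t * 2 ^ n" for n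
  proof -
    have "card (A \<inter> {1..nat \<lfloor>2 powr t * 2 ^ n\<rfloor>}) \<le> nat \<lfloor>2 powr t * 2 ^ n\<rfloor>"
      using card_mono[of "{1..nat \<lfloor>2 powr t * 2 ^ n\<rfloor>}" "A \<inter> {1..nat \<lfloor>2 powr t * 2 ^ n\<rfloor>}"] by simp
    then have "real (card (A \<inter> {1..nat \<lfloor>2 powr t * 2 ^ n\<rfloor>})) \<le> real (nat \<lfloor>2 powr t * 2 ^ n\<rfloor>)"
      by (simp only: of_nat_le_iff)
    also have "\<dots> \<le> 2 powr t * 2 ^ n" by simp
    finally show ?thesis .
  qed
  then show ?thesis
    unfolding nu_rep_def Let_def prod.case by (intro ultrafilter_bounded_tendsto) auto
qed

lemma fin_add_prob_nu: "fin_add_prob (nu \<eta>)"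
proof (transfer)
  fix x :: "betaN \<times> real"
  assume "omega_rel x x"
  then obtain \<omega> t where x: "x = (\<omega>, t)" and \<omega>: "\<omega> \<in> Nstar" by (auto simp: omega_rel_def)
  let ?c = "\<lambda>A n. real (card (A \<inter> {1..nat \<lfloor>2 powr t * 2 ^ n\<rfloor>})) / (2 powr t * 2 ^ n)"
  note lim = nu_rep_tendsto[of _ t \<omega>]
  have uniq: "nu_rep x A = l" if "(?c A \<longlongrightarrow> l) (ufilter \<omega>)" for A l
    using tendsto_unique[OF ufilter_nontriv lim that] by (simp add: x)
  have "filterlim (\<lambda>n::nat. (2::real) ^ n) at_top sequentially"
    by (rule filterlim_at_top_mono[OF filterlim_real_sequentially])
       (simp add: less_imp_le of_nat_less_two_power)
  then have inf: "filterlim (\<lambda>n::nat. 2 powr t * (2::real) ^ n) at_top sequentially"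
    by (intro filterlim_tendsto_pos_mult_at_top[OF tendsto_const]) auto
  have *: "((\<lambda>y::real. of_int \<lfloor>y\<rfloor> / y) \<longlongrightarrow> 1) at_top"
  proof (rule tendsto_sandwich)
    show "eventually (\<lambda>y::real. 1 - 1 / y \<le> of_int \<lfloor>y\<rfloor> / y) at_top"
      using eventually_gt_at_top[of 0]
    proof eventually_elim
      case (elim y)
      have "(y - 1) / y \<le> of_int \<lfloor>y\<rfloor> / y" using elim by (intro divide_right_mono) linarith+
      then show ?case using elim by (simp add: diff_divide_distrib)
    qed
    show "eventually (\<lambda>y::real. of_int \<lfloor>y\<rfloor> / y \<le> 1) at_top"
      using eventually_gt_at_top[of 0] by eventually_elim simp
    have "((\<lambda>y::real. 1 - 1 / y) \<longlongrightarrow> 1 - 0) at_top"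
      by (intro tendsto_intros tendsto_divide_0[OF tendsto_const] filterlim_at_top_imp_at_infinity filterlim_ident)
    then show "((\<lambda>y::real. 1 - 1 / y) \<longlongrightarrow> 1) at_top" by simp
  qed simp
  have "((\<lambda>n. of_int \<lfloor>2 powr t * 2 ^ n\<rfloor> / (2 powr t * 2 ^ n)) \<longlongrightarrow> (1::real)) (ufilter \<omega>)"
    by (rule tendsto_mono[OF _ filterlim_compose[OF * inf]]) (use \<omega> in \<open>simp add: Nstar_iff_free\<close>)
  moreover have "?c {1..} n = of_int \<lfloor>2 powr t * 2 ^ n\<rfloor> / (2 powr t * 2 ^ n)" for n
  proof -
    have "{1..} \<inter> {1..nat \<lfloor>2 powr t * 2 ^ n\<rfloor>} = {1..nat \<lfloor>2 powr t * 2 ^ n\<rfloor>}" by auto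
    then show ?thesis by simp
  qed
  ultimately have 1: "nu_rep x {1..} = 1" by (intro uniq) simp
  have 2: "0 \<le> nu_rep x A" for A
    unfolding x by (rule tendsto_lowerbound[OF lim _ ufilter_nontriv]) simp
  have 3: "nu_rep x (A \<union> B) = nu_rep x A + nu_rep x B" if "A \<inter> B = {}" for A B
  proof (rule uniq)
    have "?c (A \<union> B) n = ?c A n + ?c B n" for n
    proof -
      let ?I = "{1..nat \<lfloor>2 powr t * 2 ^ n\<rfloor>}"
      have "card ((A \<union> B) \<inter> ?I) = card (A \<inter> ?I) + card (B \<inter> ?I)"
        unfolding Int_Un_distrib2 using that by (intro card_Un_disjoint) auto
      then show ?thesis by (simp add: add_divide_distrib)
    qed
    then show "(?c (A \<union> B) \<longlongrightarrow> nu_rep x A + nu_rep x B) (ufilter \<omega>)"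
      using tendsto_add[OF lim[of A] lim[of B]] by (simp add: x)
  qed
  show "fin_add_prob (nu_rep x)"
    using 1 2 3 by (simp add: fin_add_prob_def)
qed

text \<open>\<open>abs_cont \<nu> \<mu>\<close> is the relation \<open>\<nu> \<lless> \<mu>\<close>.\<close>

definition abs_cont :: "(nat set \<Rightarrow> real) \<Rightarrow> (nat set \<Rightarrow> real) \<Rightarrow> bool" where
  "abs_cont \<nu> \<mu> \<longleftrightarrow> (\<forall>\<epsilon>>0. \<exists>\<delta>>0. \<forall>A\<subseteq>{1..}. \<mu> A < \<delta> \<longrightarrow> \<nu> A < \<epsilon>)"

end

theory Submission
  imports Defs
begin

text \<open>
  Counting at scale \<open>2 powr (n + t)\<close> shows that \<open>nu\<close> grows by a factor of at most \<open>2 powr s\<close> when a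
  point moves backwards by time \<open>s\<close> along the flow, which gives absolute continuity.
  Conversely, let \<open>\<eta>' = (\<omega>', t')\<close> lie outside the backward orbit of \<open>\<eta> = (\<omega>, t)\<close>, so that
  \<open>\<omega>' \<noteq> tau_pow k \<omega>\<close> for all integers \<open>k \<le> t - t'\<close>. For each \<open>m\<close>, finitely many of these
  inequalities yield \<open>B \<in> \<omega>'\<close> and \<open>C \<in> \<omega>\<close> such that no \<open>b - n\<close> with \<open>b \<in> B\<close>, \<open>n \<in> C\<close> lies in
  \<open>{-m..t - t'}\<close>. The union of the blocks \<open>(2 powr (b + t' - c), 2 powr (b + t')]\<close> over \<open>b \<in> B\<close>, where
  \<open>c > 0\<close> is the distance from \<open>t - t'\<close> to the next integer strictly above it, then has \<open>nu \<eta>'\<close>-measure at least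
  \<open>1 - 2 powr (- c)\<close>, whereas each block either lies beyond \<open>2 powr (n + t)\<close> or below
  \<open>2 powr (n - m + t')\<close>, making its \<open>nu \<eta>\<close>-measure \<open>O(2 powr (- m))\<close>.
\<close>

section \<open>Iterates of the shift, and representatives of points\<close>

lemma ufilter_tau_pow:
  assumes "p \<in> Nstar"
  shows "ufilter (tau_pow k p) = filtermap (\<lambda>n. nat (int n + k)) (ufilter p)"
  using assms
\<comment> \<open>Both induction steps peel off an innermost \<open>tau\<close>, so the shift by one
  happens before \<open>nat\<close> truncates and the formula is exact for negative \<open>k\<close>
  too; hence \<open>p\<close> must vary.\<close>
proof (induction k arbitrary: p rule: int_induct[where k = 0])
  case base
  then show ?case by (simp add: tau_pow_def filtermap_ident)
next
  case (step1 k)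
  have "ufilter (tau_pow k (tau p)) = filtermap (\<lambda>n. nat (int n + (k + 1))) (ufilter p)"
    using step1.IH[of "tau p"] step1.prems
    by (simp add: tau_Nstar ufilter_tau filtermap_filtermap algebra_simps)
  then show ?case
    by (simp only: tau_pow_tau[OF step1.prems])
next
  case (step2 k)
  define q where "q = inv_into Nstar tau p"
  have q: "q \<in> Nstar" "p = tau q"
    using step2.prems inv_tau_Nstar by (auto simp: q_def)
  then have "tau_pow (k - 1) p = tau_pow k q"
    by (simp add: tau_pow_tau)
  then show ?case
    using step2.IH[OF q(1)] q(2) by (simp add: ufilter_tau filtermap_filtermap algebra_simps)
qed

text \<open>The argument is the base-2 logarithm of the cutoff, so that moving along the flow
  becomes a translation of \<open>x\<close>.\<close>

definition density :: "nat set \<Rightarrow> real \<Rightarrow> real" where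
  "density A x = real (card (A \<inter> {1..nat \<lfloor>2 powr x\<rfloor>})) / 2 powr x"

lemma nu_rep_density: "((\<lambda>n. density A (real n + t)) \<longlongrightarrow> nu_rep (\<omega>, t) A) (ufilter \<omega>)"
proof -
  have "2 powr t * 2 ^ n = 2 powr (real n + t)" for n
    by (simp add: powr_add powr_realpow)
  with nu_rep_tendsto[of A t \<omega>] show ?thesis
    by (simp add: density_def)
qed

lemma nu_abs:
  assumes "\<omega> \<in> Nstar" "t \<in> {0..1}"
  shows "nu (abs_Omega_star (\<omega>, t)) = nu_rep (\<omega>, t)"
  by (rule nu.abs_eq) (use assms in \<open>simp add: omega_rel_def\<close>)

lemma phi_abs:
  assumes "\<omega> \<in> Nstar" "t \<in> {0..1}"
  shows "phi s (abs_Omega_star (\<omega>, t)) = abs_Omega_star (tau_pow \<lfloor>t + s\<rfloor> \<omega>, t + s - of_int \<lfloor>t + s\<rfloor>)"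
  by (subst phi.abs_eq) (use assms in \<open>simp_all add: omega_rel_def\<close>)

text \<open>The identification turns the endpoint 1 over \<omega> into 0 over
  \<open>tau \<omega>\<close>. Having the second coordinate strictly below 1 lets later floor
  computations recover the integer part.\<close>

lemma Omega_star_cases:
  obtains \<omega> t where "\<eta> = abs_Omega_star (\<omega>, t)" "\<omega> \<in> Nstar" "0 \<le> t" "t < 1"
proof -
  obtain x where x: "omega_rel x x" "\<eta> = abs_Omega_star x"
    by (induction \<eta>) auto
  obtain \<omega> t where wt: "x = (\<omega>, t)" "\<omega> \<in> Nstar" "0 \<le> t" "t \<le> 1"
    using x(1) by (auto simp: omega_rel_def)
  show ?thesis
  proof (cases "t = 1")
    case True
    then have "omega_rel x (tau \<omega>, 0)"
      using wt by (simp add: omega_rel_def tau_Nstar)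
    then have "\<eta> = abs_Omega_star (tau \<omega>, 0)"
      using x by (metis Quotient3_Omega_star Quotient3_rel omega_rel_def)
    then show ?thesis
      using that wt(2) by (simp add: tau_Nstar)
  next
    case False
    then show ?thesis
      using that x(2) wt by simp
  qed
qed

section \<open>Growth of the measures along the backward flow\<close>

lemma density_diff_le:
  assumes "0 \<le> s"
  shows "density A (x - s) \<le> 2 powr s * density A x"
proof -
  have "card (A \<inter> {1..nat \<lfloor>2 powr (x - s)\<rfloor>}) \<le> card (A \<inter> {1..nat \<lfloor>2 powr x\<rfloor>})"
  proof (intro card_mono Int_mono subset_refl)
    have "2 powr (x - s) \<le> 2 powr x"
      using assms by (intro powr_mono) auto
    then show "{1..nat \<lfloor>2 powr (x - s)\<rfloor>} \<subseteq> {1..nat \<lfloor>2 powr x\<rfloor>}"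
      by (simp add: floor_mono nat_mono)
  qed auto
  then have "density A (x - s) \<le> real (card (A \<inter> {1..nat \<lfloor>2 powr x\<rfloor>})) / 2 powr (x - s)"
    by (simp add: density_def divide_right_mono)
  also have "\<dots> = 2 powr s * density A x"
    by (simp add: density_def powr_diff)
  finally show ?thesis .
qed

lemma nu_phi_minus_le:
  assumes "0 \<le> s"
  shows "nu (phi (- s) \<eta>) A \<le> 2 powr s * nu \<eta> A"
proof -
  obtain \<omega> t where eta: "\<eta> = abs_Omega_star (\<omega>, t)" and \<omega>: "\<omega> \<in> Nstar" and "0 \<le> t" "t < 1"
    by (rule Omega_star_cases)
  then have t: "t \<in> {0..1}"
    by simp
  define k u where "k = \<lfloor>t - s\<rfloor>" and "u = t - s - of_int \<lfloor>t - s\<rfloor>"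
  have u: "u \<in> {0..1}"
    unfolding u_def atLeastAtMost_iff by linarith
  have nu': "nu (phi (- s) \<eta>) = nu_rep (tau_pow k \<omega>, u)"
    using nu_abs[OF tau_pow_Nstar[OF \<omega>, of k] u] phi_abs[OF \<omega> t, of "- s"]
    by (simp add: eta k_def u_def)
  have lim: "((\<lambda>n. density A (real (nat (int n + k)) + u)) \<longlongrightarrow> nu_rep (tau_pow k \<omega>, u) A) (ufilter \<omega>)"
    using nu_rep_density[of A u "tau_pow k \<omega>"] \<omega> by (simp add: ufilter_tau_pow filterlim_filtermap)
  \<comment> \<open>Beyond \<open>- k\<close> the truncation by \<open>nat\<close> is inactive, and
    the two scales differ by exactly \<open>s\<close>.\<close>
  have "eventually (\<lambda>n. nat (- k) \<le> n) (ufilter \<omega>)"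
    using \<omega> by (auto simp: Nstar_iff_free le_sequentially)
  then have "eventually (\<lambda>n. density A (real (nat (int n + k)) + u) \<le> 2 powr s * density A (real n + t))
      (ufilter \<omega>)"
  proof eventually_elim
    case (elim n)
    then have "real (nat (int n + k)) + u = real n + t - s"
      by (simp add: k_def u_def)
    then show ?case
      using density_diff_le[OF assms] by simp
  qed
  then have "nu_rep (tau_pow k \<omega>, u) A \<le> 2 powr s * nu_rep (\<omega>, t) A"
    by (intro tendsto_le[OF ufilter_nontriv tendsto_mult_left[OF nu_rep_density] lim])
  then show ?thesis
    using nu' nu_abs[OF \<omega> t] by (simp add: eta)
qed

lemma abs_cont_phi_minus:
  assumes "0 \<le> s"
  shows "abs_cont (nu (phi (- s) \<eta>)) (nu \<eta>)"
  unfolding abs_cont_def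
proof (intro allI impI)
  fix \<epsilon> :: real assume "\<epsilon> > 0"
  have "nu (phi (- s) \<eta>) A < \<epsilon>" if "nu \<eta> A < \<epsilon> / 2 powr s" for A
    using that nu_phi_minus_le[OF assms, of \<eta> A] by (simp add: field_simps)
  then show "\<exists>\<delta>>0. \<forall>A\<subseteq>{1..}. nu \<eta> A < \<delta> \<longrightarrow> nu (phi (- s) \<eta>) A < \<epsilon>"
    using \<open>\<epsilon> > 0\<close> by (intro exI[of _ "\<epsilon> / 2 powr s"]) simp
qed

section \<open>Backward orbits and separation of ultrafilters\<close>

lemma tau_pow_in_o_minus:
  assumes "\<omega> \<in> Nstar" "t \<in> {0..1}" "0 \<le> u" "u < 1" "of_int k \<le> t - u"
  shows "abs_Omega_star (tau_pow k \<omega>, u) \<in> o_minus (abs_Omega_star (\<omega>, t))"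
proof -
  define s where "s = t - u - of_int k"
  have "t + - s = of_int k + u"
    by (simp add: s_def)
  moreover have "\<lfloor>of_int k + u\<rfloor> = k"
    using assms by linarith
  ultimately have "abs_Omega_star (tau_pow k \<omega>, u) = phi (- s) (abs_Omega_star (\<omega>, t))"
    by (simp only: phi_abs[OF assms(1,2)]) simp
  moreover have "0 \<le> s"
    using assms(5) by (simp add: s_def)
  ultimately show ?thesis
    unfolding o_minus_def by blast
qed

text \<open>Each \<open>k\<close> gives a set in \<omega>' that is not in
  \<open>tau_pow k \<omega>\<close>; the complement, pulled back along the shift by
  \<open>k\<close>, lies in \<omega>. As \<open>K\<close> is finite, intersecting over it stays
  inside both ultrafilters.\<close>

lemma ultrafilters_separated:
  assumes "finite K" "\<omega> \<in> Nstar" "\<And>k. k \<in> K \<Longrightarrow> tau_pow k \<omega> \<noteq> \<omega>'"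
  obtains B C where "eventually (\<lambda>n. n \<in> B) (ufilter \<omega>')" "eventually (\<lambda>n. n \<in> C) (ufilter \<omega>)"
    "\<And>b n. b \<in> B \<Longrightarrow> n \<in> C \<Longrightarrow> int b - int n \<notin> K"
proof -
  have "\<exists>P. eventually P (ufilter \<omega>') \<and> \<not> eventually P (ufilter (tau_pow k \<omega>))" if "k \<in> K" for k
  proof -
    have "ufilter (tau_pow k \<omega>) \<noteq> ufilter \<omega>'"
      using assms(3)[OF that] by (simp add: ufilter_inject)
    then obtain P where "eventually P (ufilter \<omega>') \<noteq> eventually P (ufilter (tau_pow k \<omega>))"
      by (auto simp: filter_eq_iff)
    then show ?thesis
      using ufilter_not by blast
  qed
  then obtain P where P: "\<And>k. k \<in> K \<Longrightarrow> eventually (P k) (ufilter \<omega>')"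
      "\<And>k. k \<in> K \<Longrightarrow> \<not> eventually (P k) (ufilter (tau_pow k \<omega>))"
    by metis
  show ?thesis
  proof
    show "eventually (\<lambda>n. n \<in> {b. \<forall>k\<in>K. P k b}) (ufilter \<omega>')"
      using assms(1) P(1) by (simp add: eventually_ball_finite)
    have "eventually (\<lambda>n. \<not> P k (nat (int n + k))) (ufilter \<omega>)" if "k \<in> K" for k
      using P(2)[OF that] assms(2) by (simp add: ufilter_tau_pow eventually_filtermap ufilter_not)
    then show "eventually (\<lambda>n. n \<in> {n. \<forall>k\<in>K. \<not> P k (nat (int n + k))}) (ufilter \<omega>)"
      using assms(1) by (simp add: eventually_ball_finite)
    show "int b - int n \<notin> K"
      if "b \<in> {b. \<forall>k\<in>K. P k b}" "n \<in> {n. \<forall>k\<in>K. \<not> P k (nat (int n + k))}" for b n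
    proof
      assume "int b - int n \<in> K"
      with that have "P (int b - int n) b" "\<not> P (int b - int n) (nat (int n + (int b - int n)))"
        by blast+
      then show False by simp
    qed
  qed
qed

section \<open>Block sets that distinguish the two measures\<close>

definition blocks :: "real \<Rightarrow> real \<Rightarrow> nat set \<Rightarrow> nat set" where
  "blocks c u B = {a. 1 \<le> a \<and> (\<exists>b\<in>B. 2 powr (real b + u - c) < real a \<and> real a \<le> 2 powr (real b + u))}"

text \<open>The single block ending at the cutoff already suffices; the last subtracted term is the
  loss from rounding its endpoints.\<close>

lemma density_blocks_ge:
  assumes "b \<in> B"
  shows "1 - 2 powr (- c) - 1 / 2 powr (real b + u) \<le> density (blocks c u B) (real b + u)"
proof -
  define X Y where "X = 2 powr (real b + u)" and "Y = 2 powr (real b + u - c)"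
  have pos: "X > 0" "Y > 0"
    by (simp_all add: X_def Y_def)
  have "{nat \<lfloor>Y\<rfloor><..nat \<lfloor>X\<rfloor>} \<subseteq> blocks c u B \<inter> {1..nat \<lfloor>X\<rfloor>}"
  proof
    fix a assume a: "a \<in> {nat \<lfloor>Y\<rfloor><..nat \<lfloor>X\<rfloor>}"
    then have "Y < real a" "real a \<le> X"
      using pos by (auto simp: nat_less_iff le_nat_iff floor_less_iff le_floor_iff)
    with a assms show "a \<in> blocks c u B \<inter> {1..nat \<lfloor>X\<rfloor>}"
      unfolding blocks_def X_def Y_def by auto
  qed
  then have "card {nat \<lfloor>Y\<rfloor><..nat \<lfloor>X\<rfloor>} \<le> card (blocks c u B \<inter> {1..nat \<lfloor>X\<rfloor>})"
    by (intro card_mono) auto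
  then have "real (nat \<lfloor>X\<rfloor>) - real (nat \<lfloor>Y\<rfloor>) \<le> real (card (blocks c u B \<inter> {1..nat \<lfloor>X\<rfloor>}))"
    by simp
  then have "X - Y - 1 \<le> real (card (blocks c u B \<inter> {1..nat \<lfloor>X\<rfloor>}))"
    using pos by linarith
  then have "(X - Y - 1) / X \<le> density (blocks c u B) (real b + u)"
    using pos by (simp add: density_def divide_right_mono flip: X_def)
  moreover have "Y = X * 2 powr (- c)"
    by (simp add: X_def Y_def powr_diff powr_minus field_simps)
  ultimately show ?thesis
    using pos by (simp add: X_def[symmetric] diff_divide_distrib)
qed

text \<open>Blocks starting at or after scale \<open>x\<close> contribute nothing, so everything
  counted lies below \<open>2 powr y\<close>.\<close>

lemma density_blocks_le:
  assumes "\<And>b. b \<in> B \<Longrightarrow> real b + u \<le> y \<or> x \<le> real b + u - c"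
  shows "density (blocks c u B) x \<le> 2 powr (y - x)"
proof -
  have "blocks c u B \<inter> {1..nat \<lfloor>2 powr x\<rfloor>} \<subseteq> {1..nat \<lfloor>2 powr y\<rfloor>}"
  proof
    fix a assume "a \<in> blocks c u B \<inter> {1..nat \<lfloor>2 powr x\<rfloor>}"
    then obtain b where a: "1 \<le> a" "a \<le> nat \<lfloor>2 powr x\<rfloor>" and b: "b \<in> B"
        "2 powr (real b + u - c) < real a" "real a \<le> 2 powr (real b + u)"
      by (auto simp: blocks_def)
    have "real a \<le> 2 powr x"
      using a(2) by (simp add: le_nat_floor le_nat_iff le_floor_iff)
    with b(2) have "2 powr (real b + u - c) < 2 powr x"
      by (rule less_le_trans)
    then have "real b + u - c < x"
      by simp
    with assms[OF b(1)] have "real b + u \<le> y"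
      by simp
    then have "2 powr (real b + u) \<le> 2 powr y"
      by simp
    with b(3) have "real a \<le> 2 powr y"
      by linarith
    with a(1) show "a \<in> {1..nat \<lfloor>2 powr y\<rfloor>}"
      by (simp add: le_nat_floor)
  qed
  then have "card (blocks c u B \<inter> {1..nat \<lfloor>2 powr x\<rfloor>}) \<le> card {1..nat \<lfloor>2 powr y\<rfloor>}"
    by (intro card_mono) auto
  then have "real (card (blocks c u B \<inter> {1..nat \<lfloor>2 powr x\<rfloor>})) \<le> real (nat \<lfloor>2 powr y\<rfloor>)"
    by (simp only: of_nat_le_iff card_atLeastAtMost diff_Suc_1)
  also have "\<dots> \<le> 2 powr y"
    by simp
  finally show ?thesis
    by (simp add: density_def powr_diff divide_right_mono)
qed

text \<open>The order of choices matters: \<epsilon> depends only on \<open>c\<close>, while the set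
  \<open>A\<close> is built after \<delta>, through \<open>m\<close>.\<close>

lemma not_abs_cont_nu_rep:
  assumes \<omega>: "\<omega> \<in> Nstar" and \<omega>': "\<omega>' \<in> Nstar"
    and neq: "\<And>k. of_int k \<le> t - u \<Longrightarrow> tau_pow k \<omega> \<noteq> \<omega>'"
  shows "\<not> abs_cont (nu_rep (\<omega>', u)) (nu_rep (\<omega>, t))"
proof
  assume ac: "abs_cont (nu_rep (\<omega>', u)) (nu_rep (\<omega>, t))"
  \<comment> \<open>The largest block length for which the block of
    \<open>b = n + \<lfloor>t - u\<rfloor> + 1\<close> starts no earlier than scale
    \<open>n + t\<close>.\<close>
  define c where "c = of_int \<lfloor>t - u\<rfloor> + 1 - (t - u)"
  have "c > 0"
    unfolding c_def by linarith
  \<comment> \<open>Half of the limiting lower bound; the other half absorbs the rounding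
    term.\<close>
  define \<epsilon> where "\<epsilon> = (1 - 2 powr (- c)) / 2"
  have "2 powr (- c) < 2 powr 0"
    using \<open>c > 0\<close> by (intro powr_less_mono) auto
  then have "\<epsilon> > 0"
    by (simp add: \<epsilon>_def)
  then obtain \<delta> where "\<delta> > 0"
    and \<delta>: "\<And>A. A \<subseteq> {1..} \<Longrightarrow> nu_rep (\<omega>, t) A < \<delta> \<Longrightarrow> nu_rep (\<omega>', u) A < \<epsilon>"
    using ac unfolding abs_cont_def by metis
  \<comment> \<open>This makes the bound \<open>2 powr (u - t - real m)\<close> on the measure of
    \<open>A\<close> smaller than \<delta>.\<close>
  obtain m where m: "(1 / 2) ^ m < \<delta> / 2 powr (u - t)"
    using real_arch_pow_inv[of "\<delta> / 2 powr (u - t)" "1 / 2"] \<open>\<delta> > 0\<close> by auto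
  obtain B C where B: "eventually (\<lambda>n. n \<in> B) (ufilter \<omega>')" and C: "eventually (\<lambda>n. n \<in> C) (ufilter \<omega>)"
    and sep: "\<And>b n. b \<in> B \<Longrightarrow> n \<in> C \<Longrightarrow> int b - int n \<notin> {- int m..\<lfloor>t - u\<rfloor>}"
  proof (rule ultrafilters_separated[of "{- int m..\<lfloor>t - u\<rfloor>}" \<omega> \<omega>'])
    show "tau_pow k \<omega> \<noteq> \<omega>'" if "k \<in> {- int m..\<lfloor>t - u\<rfloor>}" for k
      by (rule neq) (use that in \<open>simp add: le_floor_iff\<close>)
  qed (use \<omega> in auto)
  define A where "A = blocks c u B"
  have "nu_rep (\<omega>, t) A \<le> 2 powr (u - t - real m)"
  proof (rule tendsto_upperbound[OF nu_rep_density _ ufilter_nontriv])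
    show "eventually (\<lambda>n. density A (real n + t) \<le> 2 powr (u - t - real m)) (ufilter \<omega>)"
      using C
    proof eventually_elim
      case (elim n)
      have "density A (real n + t) \<le> 2 powr ((real n - real m + u) - (real n + t))"
        unfolding A_def
      proof (rule density_blocks_le)
        fix b assume "b \<in> B"
        \<comment> \<open>An integer above the excluded interval exceeds its upper end by at least
          1, which is the 1 built into \<open>c\<close>.\<close>
        from sep[OF this elim] have "int b \<le> int n - int m \<or> int n + \<lfloor>t - u\<rfloor> + 1 \<le> int b"
          by auto
        then have "real_of_int (int b) \<le> of_int (int n - int m) \<or>
            of_int (int n + \<lfloor>t - u\<rfloor> + 1) \<le> real_of_int (int b)"
          by (simp only: of_int_le_iff)
        then show "real b + u \<le> real n - real m + u \<or> real n + t \<le> real b + u - c"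
          by (auto simp: c_def)
      qed
      then show ?case
        by (simp add: algebra_simps)
    qed
  qed
  also have "\<dots> = 2 powr (u - t) * (1 / 2) ^ m"
    by (simp add: powr_diff powr_realpow power_divide)
  also have "\<dots> < \<delta>"
    using m by (simp add: field_simps)
  finally have "nu_rep (\<omega>', u) A < \<epsilon>"
    by (intro \<delta>) (auto simp: A_def blocks_def)
  moreover have "nu_rep (\<omega>', u) A \<ge> \<epsilon>"
  proof (rule tendsto_lowerbound[OF nu_rep_density _ ufilter_nontriv])
    \<comment> \<open>From \<open>N\<close> on, the rounding term
      \<open>1 / 2 powr (real n + u)\<close> is at most \<epsilon>.\<close>
    obtain N where N: "1 / \<epsilon> / 2 powr u < 2 ^ N"
      using real_arch_pow[of 2] by auto
    have "eventually (\<lambda>n. N \<le> n) (ufilter \<omega>')"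
      using \<omega>' by (auto simp: Nstar_iff_free le_sequentially)
    then have "eventually (\<lambda>n. 1 / \<epsilon> \<le> 2 powr (real n + u)) (ufilter \<omega>')"
    proof eventually_elim
      case (elim n)
      have "1 / \<epsilon> / 2 powr u \<le> 2 ^ n"
        using N power_increasing[OF elim, of "2::real"] by linarith
      then have "1 / \<epsilon> \<le> 2 ^ n * 2 powr u"
        by (subst (asm) pos_divide_le_eq) simp_all
      then show ?case
        by (simp add: powr_add powr_realpow)
    qed
    with B show "eventually (\<lambda>n. \<epsilon> \<le> density A (real n + u)) (ufilter \<omega>')"
    proof eventually_elim
      case (elim b)
      have "1 / 2 powr (real b + u) \<le> \<epsilon>"
        using elim(2) \<open>\<epsilon> > 0\<close> by (simp add: field_simps)
      moreover have "1 - 2 powr (- c) = 2 * \<epsilon>"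
        by (simp add: \<epsilon>_def)
      ultimately show ?case
        using density_blocks_ge[OF elim(1), of c u] unfolding A_def by linarith
    qed
  qed
  ultimately show False
    by simp
qed

theorem theorem3p3:
  fixes \<eta> \<eta>' :: Omega_star
  shows "abs_cont (nu \<eta>') (nu \<eta>) \<longleftrightarrow> \<eta>' \<in> o_minus \<eta>"
proof
  assume ac: "abs_cont (nu \<eta>') (nu \<eta>)"
  obtain \<omega> t where eta: "\<eta> = abs_Omega_star (\<omega>, t)" and \<omega>: "\<omega> \<in> Nstar" and "0 \<le> t" "t < 1"
    by (rule Omega_star_cases)
  then have t: "t \<in> {0..1}"
    by simp
  obtain \<omega>' u where eta': "\<eta>' = abs_Omega_star (\<omega>', u)" and \<omega>': "\<omega>' \<in> Nstar" and u: "0 \<le> u" "u < 1"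
    by (rule Omega_star_cases)
  have "abs_cont (nu_rep (\<omega>', u)) (nu_rep (\<omega>, t))"
    using ac \<omega> \<omega>' t u by (simp add: eta eta' nu_abs)
  then obtain k where "of_int k \<le> t - u" "tau_pow k \<omega> = \<omega>'"
    using not_abs_cont_nu_rep[OF \<omega> \<omega>'] by blast
  then show "\<eta>' \<in> o_minus \<eta>"
    using tau_pow_in_o_minus[OF \<omega> t u] by (auto simp: eta eta')
next
  assume "\<eta>' \<in> o_minus \<eta>"
  then show "abs_cont (nu \<eta>') (nu \<eta>)"
    by (auto simp: o_minus_def abs_cont_phi_minus)
qed

end
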